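(* For the wheel $W_n$ on $n\ge 4$ vertices, $\sigma^-(W_n)=\lfloor (n+4)/2\rfloor$.
   Context: The wheel $W_n$ is the graph on $n$ vertices obtained by joining one central vertex to every vertex of a cycle $C_{n-1}$ (so $W_n$ is the edge-disjoint union of $K_{1,n-1}$ and $C_{n-1}$). For a graph $G$ with $N$ vertices and a bijection $f:V(G)\to\{1,\dots,N\}$, call an edge $uv$ negative under $f$ if $f(u)$ and $f(v)$ have opposite parity. The rna number $\sigma^-(G)$ is the minimum, over all such bijections $f$, of the number of negative edges under $f$. *)

theory Defs
  imports Main
begin

type_synonym 'a graph = "'a set \<times> 'a set set"

definition verts :: "'a graph \<Rightarrow> 'a set" where
  "verts G = fst G"

definition edges :: "'a graph \<Rightarrow> 'a set set" where
  "edges G = snd G"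

definition simple_graph :: "'a graph \<Rightarrow> bool" where
  "simple_graph G \<longleftrightarrow> finite (verts G) \<and> (\<forall>e\<in>edges G. e \<subseteq> verts G \<and> card e = 2)"

definition labelling :: "'a graph \<Rightarrow> ('a \<Rightarrow> nat) \<Rightarrow> bool" where
  "labelling G f \<longleftrightarrow> bij_betw f (verts G) {1..card (verts G)}"

definition negative_edges :: "'a graph \<Rightarrow> ('a \<Rightarrow> nat) \<Rightarrow> 'a set set" where
  "negative_edges G f = {e \<in> edges G. \<exists>u v. e = {u, v} \<and> even (f u) \<noteq> even (f v)}"

definition rna_number :: "'a graph \<Rightarrow> nat" where
  "rna_number G = (LEAST k. \<exists>f. labelling G f \<and> k = card (negative_edges G f))"

text \<open>The cycle on the vertices \<open>1, \<dots>, m\<close>; the successor of \<open>m\<close> is \<open>m mod m + 1 = 1\<close>.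
  This is a genuine cycle graph for \<open>m \<ge> 3\<close>.\<close>

definition cycle :: "nat \<Rightarrow> nat graph" where
  "cycle m = ({1..m}, {{i, i mod m + 1} | i. i \<in> {1..m}})"

definition wheel :: "nat \<Rightarrow> nat graph" where
  "wheel n = (insert 0 (verts (cycle (n - 1))),
              {{0, v} | v. v \<in> verts (cycle (n - 1))} \<union> edges (cycle (n - 1)))"

lemma rna_number_attained:
  assumes "finite (verts G)"
  shows "\<exists>f. labelling G f \<and> rna_number G = card (negative_edges G f)"
proof -
  obtain f where "labelling G f"
    using finite_same_card_bij[of "verts G" "{1..card (verts G)}"] assms
    by (auto simp: labelling_def)
  then have "\<exists>k f. labelling G f \<and> k = card (negative_edges G f)" by blast
  then show ?thesis unfolding rna_number_def by (rule LeastI_ex)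
qed

lemma rna_number_le:
  "labelling G f \<Longrightarrow> rna_number G \<le> card (negative_edges G f)"
  unfolding rna_number_def by (rule Least_le) blast

lemma card_verts_wheel: "n \<ge> 1 \<Longrightarrow> card (verts (wheel n)) = n"
  by (simp add: wheel_def cycle_def verts_def)

lemma simple_graph_wheel:
  assumes "n \<ge> 4"
  shows "simple_graph (wheel n)"
proof -
  have "i \<noteq> i mod (n - 1) + 1" if "i \<in> {1..n - 1}" for i
    using that assms by (cases "i = n - 1") auto
  moreover have "i mod (n - 1) + 1 \<le> n - 1" for i
    using mod_less_divisor[of "n - 1" i] assms by linarith
  ultimately show ?thesis
    by (auto simp: simple_graph_def wheel_def cycle_def verts_def edges_def card_2_iff)
qed

end

theory Submission
  imports Defs
begin

text \<open>The negative spokes are those whose rim end has parity opposite to the hub, so there are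
  \<open>n div 2\<close> or \<open>n - n div 2\<close> of them, according to whether the hub label is odd or even. Both
  parities occur on the rim, so going around the rim the parity changes at least twice. Both bounds
  are attained when the hub has label 1 and the even labels occupy consecutive rim vertices.\<close>

lemma pair_parity_iff:
  "(\<exists>u v. {a, b} = {u, v} \<and> even (f u) \<noteq> even (f v)) \<longleftrightarrow> even (f a) \<noteq> even (f b)"
  by (auto simp: doubleton_eq_iff)

lemma card_even_atLeastAtMost: "card {x \<in> {1..n::nat}. even x} = n div 2"
proof -
  have "{x \<in> {1..n}. even x} = (\<lambda>i. 2 * i) ` {1..n div 2}"
    by (auto elim!: evenE)
  then show ?thesis
    by (simp add: card_image inj_on_def)
qed

lemma card_odd_atLeastAtMost: "card {x \<in> {1..n::nat}. odd x} = n - n div 2"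
proof -
  have "{x \<in> {1..n}. odd x} = {1..n} - {x \<in> {1..n}. even x}"
    by auto
  then show ?thesis
    using card_even_atLeastAtMost[of n]
      card_Diff_subset[of "{x \<in> {1..n}. even x}" "{1..n}"] by fastforce
qed

lemma labelling_card_label_set:
  assumes "labelling G f"
  shows "card {v \<in> verts G. P (f v)} = card {x \<in> {1..card (verts G)}. P x}"
proof -
  have inj: "inj_on f (verts G)" and img: "f ` verts G = {1..card (verts G)}"
    using assms by (auto simp: labelling_def bij_betw_def)
  have "f ` {v \<in> verts G. P (f v)} = {x \<in> {1..card (verts G)}. P x}"
    unfolding img[symmetric] by auto
  moreover have "inj_on f {v \<in> verts G. P (f v)}"
    using inj by (rule inj_on_subset) auto
  ultimately show ?thesis
    using card_image by metis
qed

lemma edges_cycle: "edges (cycle m) = (\<lambda>i. {i, i mod m + 1}) ` {1..m}"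
  by (auto simp: cycle_def edges_def)

lemma verts_cycle: "verts (cycle m) = {1..m}"
  by (simp add: cycle_def verts_def)

lemma verts_wheel: "verts (wheel n) = insert 0 {1..n - 1}"
  by (simp add: wheel_def verts_def cycle_def)

lemma negative_edges_cycle:
  "negative_edges (cycle m) f =
     (\<lambda>i. {i, i mod m + 1}) ` {i \<in> {1..m}. even (f i) \<noteq> even (f (i mod m + 1))}"
  by (simp only: negative_edges_def edges_cycle Compr_image_eq pair_parity_iff)

lemma edges_wheel: "edges (wheel n) = (\<lambda>v. {0, v}) ` {1..n - 1} \<union> edges (cycle (n - 1))"
  by (auto simp: wheel_def edges_def verts_cycle)

lemma negative_edges_wheel:
  "negative_edges (wheel n) f =
     (\<lambda>v. {0, v}) ` {v \<in> verts (wheel n). even (f v) \<noteq> even (f 0)}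
     \<union> negative_edges (cycle (n - 1)) f"
proof -
  have verts: "{v \<in> verts (wheel n). even (f v) \<noteq> even (f 0)}
      = {v \<in> {1..n - 1}. even (f v) \<noteq> even (f 0)}"
    by (auto simp: verts_wheel)
  have Collect_Un: "{e \<in> A \<union> B. P e} = {e \<in> A. P e} \<union> {e \<in> B. P e}" for A B :: "'a set" and P
    by auto
  show ?thesis
    by (simp only: negative_edges_def edges_wheel verts Collect_Un Compr_image_eq pair_parity_iff
        eq_commute[of "even (f 0)"])
qed

lemma finite_negative_edges_cycle: "finite (negative_edges (cycle m) f)"
  by (simp add: negative_edges_cycle)

lemma card_negative_edges_wheel:
  "card (negative_edges (wheel n) f) =
     card {v \<in> verts (wheel n). even (f v) \<noteq> even (f 0)}
     + card (negative_edges (cycle (n - 1)) f)"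
proof -
  have "(0::nat) \<notin> e" if "e \<in> negative_edges (cycle (n - 1)) f" for e
    using that by (auto simp: negative_edges_cycle)
  then have "(\<lambda>v. {0, v}) ` {v \<in> verts (wheel n). even (f v) \<noteq> even (f 0)}
      \<inter> negative_edges (cycle (n - 1)) f = {}"
    by fastforce
  moreover have "inj_on (\<lambda>v::nat. {0, v}) A" for A
    by (auto simp: inj_on_def doubleton_eq_iff)
  moreover have "finite (verts (wheel n))"
    by (simp add: verts_wheel)
  ultimately show ?thesis
    unfolding negative_edges_wheel
    by (subst card_Un_disjoint) (simp_all add: finite_negative_edges_cycle card_image)
qed

lemma parity_change_between:
  fixes f :: "nat \<Rightarrow> nat"
  assumes "i \<le> j" and "even (f i) \<noteq> even (f j)"
  obtains t where "i \<le> t" "t < j" "even (f t) \<noteq> even (f (Suc t))"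
proof -
  have "\<exists>t. i \<le> t \<and> t < j \<and> even (f t) \<noteq> even (f (Suc t))"
    using assms
  proof (induction rule: dec_induct)
    case base
    then show ?case by simp
  next
    case (step k)
    then show ?case
      by (metis less_Suc_eq)
  qed
  then show thesis
    using that by blast
qed

lemma negative_edge_cycle_Suc:
  assumes "1 \<le> t" "t < m" "even (f t) \<noteq> even (f (Suc t))"
  shows "{t, Suc t} \<in> negative_edges (cycle m) f"
  using assms unfolding negative_edges_cycle
  by (auto intro!: image_eqI[of _ _ t])

lemma negative_edge_cycle_last:
  assumes "1 \<le> m" "even (f m) \<noteq> even (f 1)"
  shows "{m, 1} \<in> negative_edges (cycle m) f"
  using assms unfolding negative_edges_cycle
  by (auto intro!: image_eqI[of _ _ m])

lemma two_le_card_negative_edges_cycle: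
  assumes m: "m \<ge> 3" and j: "1 \<le> j" "j \<le> m" and ne: "even (f 1) \<noteq> even (f j)"
  shows "card (negative_edges (cycle m) f) \<ge> 2"
proof -
  obtain t where t: "1 \<le> t" "t < j" "even (f t) \<noteq> even (f (Suc t))"
    by (rule parity_change_between[OF j(1) ne])
  then have 1: "{t, Suc t} \<in> negative_edges (cycle m) f"
    using j by (intro negative_edge_cycle_Suc) auto
  have "\<exists>e \<in> negative_edges (cycle m) f. e \<noteq> {t, Suc t}"
  proof (cases "even (f j) = even (f m)")
    case True
    then have "{m, 1} \<in> negative_edges (cycle m) f"
      using ne m by (intro negative_edge_cycle_last) auto
    moreover have "{m, 1} \<noteq> {t, Suc t}"
      using t j m by (auto simp: doubleton_eq_iff)
    ultimately show ?thesis by (rule bexI[rotated])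
  next
    case False
    obtain s where s: "j \<le> s" "s < m" "even (f s) \<noteq> even (f (Suc s))"
      by (rule parity_change_between[OF j(2) False])
    then have "{s, Suc s} \<in> negative_edges (cycle m) f"
      using j by (intro negative_edge_cycle_Suc) auto
    moreover have "{s, Suc s} \<noteq> {t, Suc t}"
      using s t by (auto simp: doubleton_eq_iff)
    ultimately show ?thesis by (rule bexI[rotated])
  qed
  then obtain e where "e \<in> negative_edges (cycle m) f" "e \<noteq> {t, Suc t}"
    by blast
  then have "card {e, {t, Suc t}} \<le> card (negative_edges (cycle m) f)"
    using 1 finite_negative_edges_cycle by (intro card_mono) auto
  then show ?thesis
    using \<open>e \<noteq> {t, Suc t}\<close> by simp
qed

lemma labelling_wheel_card_parity:
  assumes "n \<ge> 1" "labelling (wheel n) f"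
  shows "card {v \<in> verts (wheel n). even (f v)} = n div 2"
    and "card {v \<in> verts (wheel n). odd (f v)} = n - n div 2"
  using labelling_card_label_set[OF assms(2), of even]
    labelling_card_label_set[OF assms(2), of odd] assms(1)
  by (simp_all only: card_verts_wheel card_even_atLeastAtMost card_odd_atLeastAtMost)

lemma card_negative_edges_wheel_ge:
  assumes n: "n \<ge> 4" and f: "labelling (wheel n) f"
  shows "card (negative_edges (wheel n) f) \<ge> (n + 4) div 2"
proof -
  have ev: "card {v \<in> verts (wheel n). even (f v)} = n div 2"
    and od: "card {v \<in> verts (wheel n). odd (f v)} = n - n div 2"
    using labelling_wheel_card_parity f n by auto
  have spokes: "card {v \<in> verts (wheel n). even (f v) \<noteq> even (f 0)} \<ge> n div 2"
    using ev od by (cases "even (f 0)") simp_all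
  have "\<exists>j \<in> {1..n - 1}. even (f j) \<noteq> even (f 1)"
  proof (rule ccontr)
    assume "\<not> ?thesis"
    then have "{v \<in> verts (wheel n). even (f v) \<noteq> even (f 1)} \<subseteq> {0}"
      by (auto simp: verts_wheel)
    then have "card {v \<in> verts (wheel n). even (f v) \<noteq> even (f 1)} \<le> 1"
      using card_mono[of "{0::nat}"] by fastforce
    then show False
      using ev od n by (cases "even (f 1)") simp_all
  qed
  then have "card (negative_edges (cycle (n - 1)) f) \<ge> 2"
    using two_le_card_negative_edges_cycle[of "n - 1" _ f] n by fastforce
  then show ?thesis
    using spokes by (simp add: card_negative_edges_wheel)
qed

definition wheel_labels :: "nat \<Rightarrow> nat \<Rightarrow> nat" where
  "wheel_labels n v =
     (if v = 0 then 1 else if v \<le> n div 2 then 2 * v else 2 * (v - n div 2) + 1)"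

lemma even_wheel_labels: "even (wheel_labels n v) \<longleftrightarrow> v \<noteq> 0 \<and> v \<le> n div 2"
  by (simp add: wheel_labels_def)

lemma labelling_wheel_labels:
  assumes "n \<ge> 1"
  shows "labelling (wheel n) (wheel_labels n)"
proof -
  have inj: "inj_on (wheel_labels n) (verts (wheel n))"
  proof (rule inj_onI)
    fix x y
    assume eq: "wheel_labels n x = wheel_labels n y"
    then have "(x \<noteq> 0 \<and> x \<le> n div 2) = (y \<noteq> 0 \<and> y \<le> n div 2)"
      by (metis even_wheel_labels)
    then show "x = y"
      using eq by (auto simp: wheel_labels_def split: if_splits)
  qed
  have "wheel_labels n ` verts (wheel n) \<subseteq> {1..n}"
    using assms by (auto simp: wheel_labels_def verts_wheel)
  then have "wheel_labels n ` verts (wheel n) = {1..n}"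
    using inj assms by (intro card_subset_eq) (simp_all add: card_image card_verts_wheel)
  then show ?thesis
    using inj assms by (simp add: labelling_def bij_betw_def card_verts_wheel)
qed

lemma negative_edges_cycle_wheel_labels:
  "negative_edges (cycle (n - 1)) (wheel_labels n)
     \<subseteq> {{n div 2, n div 2 + 1}, {n - 1, 1}}"
proof
  fix e
  assume "e \<in> negative_edges (cycle (n - 1)) (wheel_labels n)"
  then obtain i where i: "i \<in> {1..n - 1}" "e = {i, i mod (n - 1) + 1}"
    and "even (wheel_labels n i) \<noteq> even (wheel_labels n (i mod (n - 1) + 1))"
    unfolding negative_edges_cycle by auto
  then show "e \<in> {{n div 2, n div 2 + 1}, {n - 1, 1}}"
    by (cases "i = n - 1") (auto simp: even_wheel_labels)
qed

lemma card_negative_edges_wheel_labels: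
  assumes "n \<ge> 1"
  shows "card (negative_edges (wheel n) (wheel_labels n)) \<le> (n + 4) div 2"
proof -
  have "card {v \<in> verts (wheel n). even (wheel_labels n v)} = n div 2"
    using labelling_wheel_card_parity(1) labelling_wheel_labels assms by blast
  moreover have "odd (wheel_labels n 0)"
    by (simp add: even_wheel_labels)
  moreover have "card (negative_edges (cycle (n - 1)) (wheel_labels n)) \<le> 2"
    using card_mono[OF _ negative_edges_cycle_wheel_labels[of n]]
      card_insert_le_m1[of 2 "{{n - 1, 1}}" "{n div 2, n div 2 + 1}"] by simp
  ultimately show ?thesis
    by (simp add: card_negative_edges_wheel)
qed

theorem theorem12:
  fixes n :: nat
  assumes "n \<ge> 4"
  shows "rna_number (wheel n) = (n + 4) div 2"
proof (rule antisym)
  show "rna_number (wheel n) \<le> (n + 4) div 2"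
    using rna_number_le[OF labelling_wheel_labels] card_negative_edges_wheel_labels assms
    by (meson le_trans one_le_numeral)
  obtain f where "labelling (wheel n) f"
      "rna_number (wheel n) = card (negative_edges (wheel n) f)"
    using rna_number_attained[of "wheel n"] by (auto simp: verts_wheel)
  then show "(n + 4) div 2 \<le> rna_number (wheel n)"
    using card_negative_edges_wheel_ge assms by simp
qed

end
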